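(* Let $G=\{(x,y)\in\mathbb N^2:\gcd(x,y)=1\}$ be the set of pairs of positive integers that are coprime. Then $$\ell(G,\mathcal M^2_F)= u(G,\mathcal M^2_F)=u(G,\mathcal M^2_S)=u(G,\mathcal M^2_R)=\frac{6}{\pi^2}$$ and $$\ell(G,\mathcal M^2_S)=\ell(G,\mathcal M^2_R)=0.$$
   Context: $\mathbb N=\{1,2,3,\dots\}$ and $[n]=\{1,\dots,n\}$. A finitely additive probability on a set $\Omega$ is a function $\mu:2^{\Omega}\to[0,1]$ with $\mu(\Omega)=1$ and $\mu(A\cup B)=\mu(A)+\mu(B)$ for disjoint $A,B\subseteq\Omega$. Limiting relative frequency: let $\mathcal C_F^2$ be the collection of all $C\subseteq\mathbb N^2$ for which $\lim_{\min(n_1,n_2)\to\infty}\frac{\#(C\cap([n_1]\times[n_2]))}{n_1n_2}$ exists; $\mathcal M_F^2$ is the set of all finitely additive probabilities $\mu$ on $\mathbb N^2$ such that $\mu(C)$ equals this limit for every $C\in\mathcal C_F^2$. Shift invariance: for $j=1,2$ let $s_j:\mathbb N^2\to\mathbb N^2$ be the map increasing the $j$th coordinate by one; $\mathcal M_S^2$ is the set of all finitely additive probabilities $\mu$ on $\mathbb N^2$ with $\mu(A)=\mu(s_j^{-1}(A))$ for all $A\subseteq\mathbb N^2$ and $j=1,2$. Residue classes: for $k\in\mathbb N$ and $j\in\{0,\dots,k-1\}$ let $R_{j,k}=\{x\in\mathbb N: x\equiv j \bmod k\}$; $\mathcal M_R^2$ is the set of all finitely additive probabilities $\mu$ on $\mathbb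 N^2$ with $\mu(R_{j_1,k_1}\times R_{j_2,k_2})=1/(k_1k_2)$ for all $k_1,k_2\in\mathbb N$, $j_1\in\{0,\dots,k_1-1\}$, $j_2\in\{0,\dots,k_2-1\}$. For such a class $\mathcal M$ and a set $D\subseteq \mathbb N^2$, the numbers $\ell(D,\mathcal M)$ and $u(D,\mathcal M)$ are the endpoints of the closed interval $\{\mu(D):\mu\in\mathcal M\}=[\ell(D,\mathcal M),u(D,\mathcal M)]$, i.e. the minimum and maximum of $\mu(D)$ over $\mu\in\mathcal M$. *)

theory Defs
  imports Complex_Main "HOL-Number_Theory.Cong"
begin

text \<open>The naturals of the source start at 1, so sets of pairs are taken relative to
  \<open>pos_nat \<times> pos_nat\<close>.\<close>

definition pos_nat :: "nat set" where
  "pos_nat = {1..}"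

definition pos_nat2 :: "(nat \<times> nat) set" where
  "pos_nat2 = pos_nat \<times> pos_nat"

text \<open>A charge is a total function on \<open>'a set\<close>; its values on sets that are not subsets of
  \<open>\<Omega>\<close> are irrelevant and left unconstrained.\<close>

definition fin_add_prob :: "'a set \<Rightarrow> ('a set \<Rightarrow> real) \<Rightarrow> bool" where
  "fin_add_prob \<Omega> \<mu> \<longleftrightarrow>
     (\<forall>A. A \<subseteq> \<Omega> \<longrightarrow> \<mu> A \<in> {0..1}) \<and>
     \<mu> \<Omega> = 1 \<and>
     (\<forall>A B. A \<subseteq> \<Omega> \<longrightarrow> B \<subseteq> \<Omega> \<longrightarrow> A \<inter> B = {} \<longrightarrow> \<mu> (A \<union> B) = \<mu> A + \<mu> B)"

definition rel_freq :: "(nat \<times> nat) set \<Rightarrow> nat \<times> nat \<Rightarrow> real" where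
  "rel_freq C = (\<lambda>(n1, n2). real (card (C \<inter> ({1..n1} \<times> {1..n2}))) / (real n1 * real n2))"

definition min_at_top :: "(nat \<times> nat) filter" where
  "min_at_top = filtercomap (\<lambda>(n1, n2). min n1 n2) at_top"

definition C_F :: "(nat \<times> nat) set set" where
  "C_F = {C. C \<subseteq> pos_nat2 \<and> (\<exists>L. (rel_freq C \<longlongrightarrow> L) min_at_top)}"

definition M_F :: "((nat \<times> nat) set \<Rightarrow> real) set" where
  "M_F = {\<mu>. fin_add_prob pos_nat2 \<mu> \<and> (\<forall>C\<in>C_F. (rel_freq C \<longlongrightarrow> \<mu> C) min_at_top)}"

definition shift1 :: "nat \<times> nat \<Rightarrow> nat \<times> nat" where
  "shift1 = (\<lambda>(x, y). (x + 1, y))"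

definition shift2 :: "nat \<times> nat \<Rightarrow> nat \<times> nat" where
  "shift2 = (\<lambda>(x, y). (x, y + 1))"

text \<open>The shifts are maps on \<open>pos_nat2\<close>, hence the intersection with \<open>pos_nat2\<close>
  in the preimages.\<close>

definition M_S :: "((nat \<times> nat) set \<Rightarrow> real) set" where
  "M_S = {\<mu>. fin_add_prob pos_nat2 \<mu> \<and>
     (\<forall>s\<in>{shift1, shift2}. \<forall>A. A \<subseteq> pos_nat2 \<longrightarrow> \<mu> A = \<mu> (s -` A \<inter> pos_nat2))}"

definition residue_class :: "nat \<Rightarrow> nat \<Rightarrow> nat set" where
  "residue_class j k = {x \<in> pos_nat. [x = j] (mod k)}"

definition M_R :: "((nat \<times> nat) set \<Rightarrow> real) set" where
  "M_R = {\<mu>. fin_add_prob pos_nat2 \<mu> \<and>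
     (\<forall>k1\<in>pos_nat. \<forall>k2\<in>pos_nat. \<forall>j1\<in>{0..<k1}. \<forall>j2\<in>{0..<k2}.
        \<mu> (residue_class j1 k1 \<times> residue_class j2 k2) = 1 / (real k1 * real k2))}"

text \<open>\<open>lower\<close> and \<open>upper\<close> are the infimum and supremum of the values at \<open>D\<close>. That these are
  attained, and that \<open>value_range D M = {lower D M..upper D M}\<close>, is not part of the definitions.\<close>

definition value_range :: "'a set \<Rightarrow> ('a set \<Rightarrow> real) set \<Rightarrow> real set" where
  "value_range D M = {\<mu> D | \<mu>. \<mu> \<in> M}"

definition lower :: "'a set \<Rightarrow> ('a set \<Rightarrow> real) set \<Rightarrow> real" where
  "lower D M = Inf (value_range D M)"

definition upper :: "'a set \<Rightarrow> ('a set \<Rightarrow> real) set \<Rightarrow> real" where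
  "upper D M = Sup (value_range D M)"

definition coprime_pairs :: "(nat \<times> nat) set" where
  "coprime_pairs = {(x, y). (x, y) \<in> pos_nat2 \<and> gcd x y = 1}"

end

theory Submission
  imports Defs "HOL-Analysis.Analysis"
begin

text \<open>All charges in \<open>M_R\<close> agree on periodic sets, in particular on the set of pairs without a common
  divisor in \<open>{2..N}\<close>, which exceeds the coprime pairs only by pairs with greatest common divisor
  above \<open>N\<close>. Hence a charge \<open>\<nu>\<close> in \<open>M_R\<close> with \<open>\<nu> {gcd > N} \<longlongrightarrow> 0\<close> is maximal at the coprime pairs,
  and a scaling argument identifies its value there as \<open>6 / \<pi>\<^sup>2\<close>. Cluster points of the relative
  frequencies are shift invariant and satisfy this tail condition, so by compactness the relative
  frequency of the coprime pairs converges to that value. For the lower bound, the Chinese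
  remainder theorem yields arbitrarily large squares without coprime pairs; a cluster point of the
  uniform distributions on them is shift invariant and vanishes at the coprime pairs.\<close>

section \<open>Finitely additive probabilities: convexity and compactness\<close>

lemma fin_add_prob_bounds:
  assumes "fin_add_prob \<Omega> \<mu>" "A \<subseteq> \<Omega>"
  shows "0 \<le> \<mu> A" "\<mu> A \<le> 1"
  using assms by (auto simp: fin_add_prob_def)

lemma fin_add_prob_Un:
  assumes "fin_add_prob \<Omega> \<mu>" "A \<subseteq> \<Omega>" "B \<subseteq> \<Omega>" "A \<inter> B = {}"
  shows "\<mu> (A \<union> B) = \<mu> A + \<mu> B"
  using assms by (auto simp: fin_add_prob_def)

lemma fin_add_prob_space: "fin_add_prob \<Omega> \<mu> \<Longrightarrow> \<mu> \<Omega> = 1"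
  by (auto simp: fin_add_prob_def)

lemma fin_add_prob_empty: "fin_add_prob \<Omega> \<mu> \<Longrightarrow> \<mu> {} = 0"
  using fin_add_prob_Un[of \<Omega> \<mu> "{}" "{}"] by simp

lemma fin_add_prob_mono:
  assumes "fin_add_prob \<Omega> \<mu>" "A \<subseteq> B" "B \<subseteq> \<Omega>"
  shows "\<mu> A \<le> \<mu> B"
proof -
  have "\<mu> (A \<union> (B - A)) = \<mu> A + \<mu> (B - A)"
    using assms by (intro fin_add_prob_Un[OF assms(1)]) auto
  moreover have "A \<union> (B - A) = B" using assms by auto
  moreover have "0 \<le> \<mu> (B - A)"
    using fin_add_prob_bounds(1)[OF assms(1), of "B - A"] assms by auto
  ultimately show ?thesis by simp
qed

lemma fin_add_prob_Un_le:
  assumes "fin_add_prob \<Omega> \<mu>" "A \<subseteq> \<Omega>" "B \<subseteq> \<Omega>"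
  shows "\<mu> (A \<union> B) \<le> \<mu> A + \<mu> B"
proof -
  have "\<mu> (A \<union> (B - A)) = \<mu> A + \<mu> (B - A)"
    using assms by (intro fin_add_prob_Un[OF assms(1)]) auto
  moreover have "\<mu> (B - A) \<le> \<mu> B"
    using assms by (intro fin_add_prob_mono[of \<Omega>]) auto
  ultimately show ?thesis by simp
qed

lemma fin_add_prob_UN:
  assumes "fin_add_prob \<Omega> \<mu>" "finite I" "\<And>i. i \<in> I \<Longrightarrow> A i \<subseteq> \<Omega>" "disjoint_family_on A I"
  shows "\<mu> (\<Union>i\<in>I. A i) = (\<Sum>i\<in>I. \<mu> (A i))"
  using assms(2-4)
proof (induction I)
  case empty
  then show ?case using fin_add_prob_empty[OF assms(1)] by simp
next
  case (insert i I)
  have "\<mu> (A i \<union> (\<Union>i\<in>I. A i)) = \<mu> (A i) + \<mu> (\<Union>i\<in>I. A i)"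
    using insert.prems insert.hyps
    by (intro fin_add_prob_Un[OF assms(1)]) (auto simp: disjoint_family_on_def)
  moreover have "\<mu> (\<Union>i\<in>I. A i) = (\<Sum>i\<in>I. \<mu> (A i))"
    using insert.prems insert.IH by (auto simp: disjoint_family_on_def)
  ultimately show ?case using insert.hyps by simp
qed

lemma fin_add_prob_mix:
  assumes "fin_add_prob \<Omega> \<mu>" "fin_add_prob \<Omega> \<nu>" "0 \<le> t" "t \<le> 1"
  shows "fin_add_prob \<Omega> (\<lambda>A. (1 - t) * \<mu> A + t * \<nu> A)"
  unfolding fin_add_prob_def
proof (intro conjI allI impI)
  fix A assume "A \<subseteq> \<Omega>"
  note b = fin_add_prob_bounds[OF assms(1) this] fin_add_prob_bounds[OF assms(2) this]
  have "(1 - t) * \<mu> A + t * \<nu> A \<le> 1"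
    by (rule convex_bound_le) (use b assms in auto)
  then show "(1 - t) * \<mu> A + t * \<nu> A \<in> {0..1}"
    using b assms by auto
qed (use assms in \<open>auto simp: fin_add_prob_Un fin_add_prob_space algebra_simps\<close>)

text \<open>Banach limits without ultrafilters: by Tychonoff the charges have a cluster point in the
  compact product space \<open>[0,1]\<^bsup>Pow \<Omega>\<^esup>\<close>.\<close>

lemma fin_add_prob_cluster:
  fixes f :: "'i \<Rightarrow> 'a set \<Rightarrow> real"
  assumes F: "F \<noteq> bot" and f: "\<forall>\<^sub>F i in F. fin_add_prob \<Omega> (f i)"
  obtains \<mu> F' where "fin_add_prob \<Omega> \<mu>" "F' \<le> F" "F' \<noteq> bot"
    "\<And>A. A \<subseteq> \<Omega> \<Longrightarrow> ((\<lambda>i. f i A) \<longlongrightarrow> \<mu> A) F'"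
proof -
  \<comment> \<open>Values outside the subsets of \<open>\<Omega>\<close> are unconstrained, so
    arguments are cut down to \<open>\<Omega>\<close> to keep every coordinate in the unit
    interval.\<close>
  define g where "g i A = f i (A \<inter> \<Omega>)" for i A
  define K :: "('a set \<Rightarrow> real) set" where "K = (\<Pi>\<^sub>E A\<in>UNIV. {0..1})"
  have "compactin (product_topology (\<lambda>_::'a set. euclidean::real topology) UNIV) K"
    unfolding K_def compactin_PiE by auto
  then have "compact K"
    unfolding euclidean_product_topology by simp
  moreover have "filtermap g F \<noteq> bot"
    using F by (simp add: filtermap_bot_iff)
  moreover have "\<forall>\<^sub>F x in filtermap g F. x \<in> K"
    unfolding eventually_filtermap using f
    by eventually_elim (auto simp: K_def g_def fin_add_prob_bounds)
  ultimately obtain \<mu> where \<mu>: "\<mu> \<in> K" "inf (nhds \<mu>) (filtermap g F) \<noteq> bot"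
    unfolding compact_filter by blast
  \<comment> \<open>The cluster point lives on the space of charges; pulling its neighbourhoods back
    along \<open>g\<close> gives a filter on the indices, finer than \<open>F\<close>, along which
    \<open>g\<close> converges.\<close>
  define F' where "F' = inf (filtercomap g (nhds \<mu>)) F"
  have F'bot: "F' \<noteq> bot"
  proof
    assume "F' = bot"
    then have "\<forall>\<^sub>F _ in F'. False" by simp
    then obtain P Q where PQ: "eventually P (nhds \<mu>)" "eventually Q F" "\<And>x. P (g x) \<Longrightarrow> Q x \<Longrightarrow> False"
      unfolding F'_def eventually_inf eventually_filtercomap by metis
    have "\<forall>\<^sub>F x in filtermap g F. \<not> P x"
      unfolding eventually_filtermap using PQ(2) by eventually_elim (use PQ(3) in auto)
    then have "\<forall>\<^sub>F _ in inf (nhds \<mu>) (filtermap g F). False"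
      unfolding eventually_inf using PQ(1) by blast
    then show False using \<mu>(2) by simp
  qed
  have "filtermap g F' \<le> nhds \<mu>"
    unfolding F'_def by (meson filtermap_filtercomap filtermap_mono inf_le1 order_trans)
  then have "(g \<longlongrightarrow> \<mu>) F'" by (simp add: filterlim_def)
  then have g: "((\<lambda>i. g i A) \<longlongrightarrow> \<mu> A) F'" for A
    by (rule continuous_on_tendsto_compose[OF continuous_on_product_coordinates[of A]]) auto
  have lim: "((\<lambda>i. f i A) \<longlongrightarrow> \<mu> A) F'" if "A \<subseteq> \<Omega>" for A
    using g[of A] that by (simp add: g_def Int_absorb2)
  have F'le: "F' \<le> F" by (simp add: F'_def)
  have f': "\<forall>\<^sub>F i in F'. fin_add_prob \<Omega> (f i)"
    using f F'le by (auto simp: le_filter_def)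
  have "fin_add_prob \<Omega> \<mu>"
    unfolding fin_add_prob_def
  proof (intro conjI allI impI)
    show "\<mu> A \<in> {0..1}" for A using \<mu>(1) by (auto simp: K_def)
    have "\<forall>\<^sub>F i in F'. f i \<Omega> = 1"
      using f' by eventually_elim (rule fin_add_prob_space)
    then have "((\<lambda>i. f i \<Omega>) \<longlongrightarrow> 1) F'" by (rule tendsto_eventually)
    then show "\<mu> \<Omega> = 1" using lim[of \<Omega>] tendsto_unique[OF F'bot] by blast
  next
    fix A B assume AB: "A \<subseteq> \<Omega>" "B \<subseteq> \<Omega>" "A \<inter> B = {}"
    have "\<forall>\<^sub>F i in F'. f i (A \<union> B) = f i A + f i B"
      using f' by eventually_elim (use AB in \<open>auto intro: fin_add_prob_Un\<close>)
    moreover have "((\<lambda>i. f i A + f i B) \<longlongrightarrow> \<mu> A + \<mu> B) F'"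
      using AB by (intro tendsto_add lim)
    ultimately have "((\<lambda>i. f i (A \<union> B)) \<longlongrightarrow> \<mu> A + \<mu> B) F'"
      by (simp add: tendsto_cong)
    then show "\<mu> (A \<union> B) = \<mu> A + \<mu> B"
      using lim[of "A \<union> B"] AB tendsto_unique[OF F'bot] by blast
  qed
  then show ?thesis using that F'le F'bot lim by blast
qed

section \<open>Uniform charges on boxes and their shift-invariant limits\<close>

text \<open>For an empty or infinite \<open>B\<close> both cardinalities involving \<open>B\<close>
  degenerate and division by zero gives 0, so only finite nonempty \<open>B\<close> yield
  probabilities.\<close>

definition uniform_charge :: "'a set \<Rightarrow> 'a set \<Rightarrow> real" where
  "uniform_charge B A = real (card (A \<inter> B)) / real (card B)"

lemma fin_add_prob_uniform_charge:
  assumes "finite B" "B \<noteq> {}" "B \<subseteq> \<Omega>"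
  shows "fin_add_prob \<Omega> (uniform_charge B)"
  unfolding fin_add_prob_def
proof (intro conjI allI impI)
  have pos: "0 < card B" using assms by (simp add: card_gt_0_iff)
  show "uniform_charge B A \<in> {0..1}" for A
    using pos assms(1) by (auto simp: uniform_charge_def intro!: card_mono)
  show "uniform_charge B \<Omega> = 1"
    using pos assms by (simp add: uniform_charge_def Int_absorb1)
  fix X Y :: "'a set" assume "X \<inter> Y = {}"
  then have "card ((X \<union> Y) \<inter> B) = card (X \<inter> B) + card (Y \<inter> B)"
    using assms(1) by (subst card_Un_disjoint[symmetric]) (auto intro!: arg_cong[of _ _ card])
  then show "uniform_charge B (X \<union> Y) = uniform_charge B X + uniform_charge B Y"
    by (simp add: uniform_charge_def add_divide_distrib)
qed

text \<open>By injectivity, the part of the preimage in \<open>B\<close> corresponds to the part of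
  \<open>A\<close> in the image of \<open>B\<close>. The two counts thus differ only through points
  in exactly one of \<open>B\<close> and its image, and as these have equal size, the two
  differences do too.\<close>

lemma uniform_charge_vimage:
  assumes "finite B" "inj s"
  shows "\<bar>uniform_charge B A - uniform_charge B (s -` A)\<bar> \<le> real (card (B - s ` B)) / real (card B)"
proof -
  have img: "s ` (s -` A \<inter> B) = A \<inter> s ` B" by auto
  have c0: "card (s -` A \<inter> B) = card (A \<inter> s ` B)"
    unfolding img[symmetric] by (rule card_image[symmetric]) (meson assms(2) inj_on_subset subset_UNIV)
  have cB: "card (s ` B) = card B"
    by (rule card_image) (meson assms(2) inj_on_subset subset_UNIV)
  have sym: "card (s ` B - B) = card (B - s ` B)"
  proof -
    have "card B = card (B \<inter> s ` B) + card (B - s ` B)" "card (s ` B) = card (s ` B \<inter> B) + card (s ` B - B)"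
      using assms(1) by (simp_all add: card_Int_Diff)
    then show ?thesis using cB by (simp add: Int_commute)
  qed
  have le: "card (A \<inter> X) \<le> card (A \<inter> Y) + card (X - Y)" if "finite X" "finite Y" for X Y
    by (rule order_trans[OF card_mono card_Un_le]) (use that in auto)
  have "\<bar>real (card (A \<inter> B)) - real (card (s -` A \<inter> B))\<bar> \<le> real (card (B - s ` B))"
    using le[of B "s ` B"] le[of "s ` B" B] assms(1) sym c0 by auto
  then show ?thesis
    by (simp add: uniform_charge_def diff_divide_distrib[symmetric] divide_right_mono)
qed

text \<open>\<open>a\<close> and \<open>b\<close> are offsets, \<open>m\<close> and \<open>n\<close>
  side lengths. Starting at \<open>a+1\<close> and \<open>b+1\<close> keeps every box inside
  \<open>pos_nat2\<close> and makes \<open>box 0 m 0 n\<close> the initial rectangle of the relative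
  frequencies.\<close>

definition box :: "nat \<Rightarrow> nat \<Rightarrow> nat \<Rightarrow> nat \<Rightarrow> (nat \<times> nat) set" where
  "box a m b n = {a+1..a+m} \<times> {b+1..b+n}"

lemma card_box: "card (box a m b n) = m * n"
  by (simp add: box_def card_cartesian_product)

text \<open>Any point off the first column is the shift of its left neighbour, which still lies in
  the box.\<close>

lemma box_boundary1: "card (box a m b n - shift1 ` box a m b n) \<le> n"
proof -
  have "box a m b n - shift1 ` box a m b n \<subseteq> {a+1} \<times> {b+1..b+n}"
  proof
    fix p assume p: "p \<in> box a m b n - shift1 ` box a m b n"
    obtain x y where xy: "p = (x, y)" by (cases p)
    have "x = a + 1"
    proof (rule ccontr)
      assume "x \<noteq> a + 1"
      then have "(x - 1, y) \<in> box a m b n" "p = shift1 (x - 1, y)"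
        using p xy by (auto simp: box_def shift1_def)
      then show False using p by blast
    qed
    then show "p \<in> {a+1} \<times> {b+1..b+n}" using p xy by (auto simp: box_def)
  qed
  then have "card (box a m b n - shift1 ` box a m b n) \<le> card ({a+1} \<times> {b+1..b+n})"
    by (intro card_mono) auto
  then show ?thesis by (simp add: card_cartesian_product)
qed

lemma box_boundary2: "card (box a m b n - shift2 ` box a m b n) \<le> m"
proof -
  have "box a m b n - shift2 ` box a m b n \<subseteq> {a+1..a+m} \<times> {b+1}"
  proof
    fix p assume p: "p \<in> box a m b n - shift2 ` box a m b n"
    obtain x y where xy: "p = (x, y)" by (cases p)
    have "y = b + 1"
    proof (rule ccontr)
      assume "y \<noteq> b + 1"
      then have "(x, y - 1) \<in> box a m b n" "p = shift2 (x, y - 1)"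
        using p xy by (auto simp: box_def shift2_def)
      then show False using p by blast
    qed
    then show "p \<in> {a+1..a+m} \<times> {b+1}" using p xy by (auto simp: box_def)
  qed
  then have "card (box a m b n - shift2 ` box a m b n) \<le> card ({a+1..a+m} \<times> {b+1})"
    by (intro card_mono) auto
  then show ?thesis by (simp add: card_cartesian_product)
qed

text \<open>A shift changes the uniform charge by at most boundary over area, here 1/m + 1/n, which
  vanishes in the limit wherever the boxes are placed. The freedom of the offsets serves the lower
  bound.\<close>

lemma box_limit_M_S:
  fixes a m b n :: "'i \<Rightarrow> nat"
  assumes F: "F \<noteq> bot" and m: "filterlim m at_top F" and n: "filterlim n at_top F"
  obtains \<mu> F' where "\<mu> \<in> M_S" "F' \<le> F" "F' \<noteq> bot"
    "\<And>A. A \<subseteq> pos_nat2 \<Longrightarrow>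
       ((\<lambda>i. uniform_charge (box (a i) (m i) (b i) (n i)) A) \<longlongrightarrow> \<mu> A) F'"
proof -
  define B where "B i = box (a i) (m i) (b i) (n i)" for i
  have fin: "finite (B i)" for i by (simp add: B_def box_def)
  have sub: "B i \<subseteq> pos_nat2" for i by (auto simp: B_def box_def pos_nat2_def pos_nat_def)
  have m1: "\<forall>\<^sub>F i in F. m i \<ge> 1" and n1: "\<forall>\<^sub>F i in F. n i \<ge> 1"
    using m n by (auto simp: filterlim_at_top)
  have "\<forall>\<^sub>F i in F. fin_add_prob pos_nat2 (uniform_charge (B i))"
    using m1 n1 by eventually_elim
      (rule fin_add_prob_uniform_charge[OF fin _ sub], auto simp: B_def box_def)
  from fin_add_prob_cluster[OF F this] obtain \<mu> F' where
    \<mu>: "fin_add_prob pos_nat2 \<mu>" "F' \<le> F" "F' \<noteq> bot"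
      "\<And>A. A \<subseteq> pos_nat2 \<Longrightarrow> ((\<lambda>i. uniform_charge (B i) A) \<longlongrightarrow> \<mu> A) F'"
    by blast
  have inj: "inj shift1" "inj shift2" by (auto simp: inj_def shift1_def shift2_def)
  have bd: "\<forall>\<^sub>F i in F'. \<bar>uniform_charge (B i) A - uniform_charge (B i) (s -` A)\<bar> \<le> 1 / real (m i) + 1 / real (n i)"
    if s: "s \<in> {shift1, shift2}" for s A
  proof -
    have "\<forall>\<^sub>F i in F. \<bar>uniform_charge (B i) A - uniform_charge (B i) (s -` A)\<bar> \<le> 1 / real (m i) + 1 / real (n i)"
      using m1 n1
    proof eventually_elim
      case (elim i)
      have "real (card (B i - s ` B i)) \<le> real (m i) + real (n i)"
        using s box_boundary1[of "a i" "m i" "b i" "n i"] box_boundary2[of "a i" "m i" "b i" "n i"]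
        by (auto simp: B_def)
      then have "real (card (B i - s ` B i)) / real (card (B i)) \<le> (real (m i) + real (n i)) / (real (m i) * real (n i))"
        by (simp add: B_def card_box divide_right_mono)
      also have "\<dots> = 1 / real (m i) + 1 / real (n i)" using elim by (simp add: field_simps)
      finally show ?case
        using uniform_charge_vimage[OF fin[of i], of s A] s inj by auto
    qed
    then show ?thesis using \<mu>(2) by (auto simp: le_filter_def)
  qed
  have "((\<lambda>i. 1 / real (m i) + 1 / real (n i)) \<longlongrightarrow> 0 + 0) F"
    by (intro tendsto_add tendsto_divide_0[OF tendsto_const] filterlim_at_top_imp_at_infinity
        filterlim_compose[OF filterlim_real_sequentially] m n)
  then have z: "((\<lambda>i. 1 / real (m i) + 1 / real (n i)) \<longlongrightarrow> 0) F'"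
    using \<mu>(2) by (auto intro: tendsto_mono)
  have "\<mu> A = \<mu> (s -` A \<inter> pos_nat2)" if s: "s \<in> {shift1, shift2}" and A: "A \<subseteq> pos_nat2" for s A
  proof -
    \<comment> \<open>The uniform charge sees only points of \<open>B i\<close>, all of which are in
      \<open>pos_nat2\<close>.\<close>
    have eq: "uniform_charge (B i) (s -` A \<inter> pos_nat2) = uniform_charge (B i) (s -` A)" for i
      using sub[of i] by (simp add: uniform_charge_def Int_assoc Int_absorb1)
    have "((\<lambda>i. uniform_charge (B i) A - uniform_charge (B i) (s -` A \<inter> pos_nat2)) \<longlongrightarrow> \<mu> A - \<mu> (s -` A \<inter> pos_nat2)) F'"
      using A by (intro tendsto_diff \<mu>(4)) auto
    moreover have "((\<lambda>i. uniform_charge (B i) A - uniform_charge (B i) (s -` A \<inter> pos_nat2)) \<longlongrightarrow> 0) F'"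
      unfolding eq by (rule Lim_null_comparison[OF _ z]) (use bd[OF s] in simp)
    ultimately have "\<mu> A - \<mu> (s -` A \<inter> pos_nat2) = 0"
      using tendsto_unique[OF \<mu>(3)] by blast
    then show ?thesis by simp
  qed
  then have "\<mu> \<in> M_S" using \<mu>(1) by (auto simp: M_S_def)
  with \<mu> show ?thesis using that unfolding B_def by blast
qed

section \<open>Shift invariance and residue classes\<close>

lemma residue_class_subset: "residue_class j k \<subseteq> pos_nat"
  by (auto simp: residue_class_def)

lemma residue_rect_subset: "residue_class i k \<times> residue_class j l \<subseteq> pos_nat2"
  using residue_class_subset by (auto simp: pos_nat2_def)

lemma cong_Suc: "[Suc x = Suc i] (mod k) \<longleftrightarrow> [x = i] (mod k)"
  using cong_add_rcancel_nat[of x 1 i k] by simp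

text \<open>Shifts carry the residue rectangles for fixed moduli into one another, so all have the
  same charge; there are \<open>k1 * k2\<close> of them and they partition
  \<open>pos_nat2\<close>.\<close>

lemma M_S_subset_M_R: "M_S \<subseteq> M_R"
proof
  fix \<mu> assume \<mu>: "\<mu> \<in> M_S"
  then have prob: "fin_add_prob pos_nat2 \<mu>"
    and inv: "\<And>s A. s \<in> {shift1, shift2} \<Longrightarrow> A \<subseteq> pos_nat2 \<Longrightarrow> \<mu> A = \<mu> (s -` A \<inter> pos_nat2)"
    unfolding M_S_def by blast+
  have "\<mu> (residue_class j1 k1 \<times> residue_class j2 k2) = 1 / (real k1 * real k2)"
    if k: "k1 \<in> pos_nat" "k2 \<in> pos_nat" for k1 k2 j1 j2
  proof -
    define N where "N i j = \<mu> (residue_class i k1 \<times> residue_class j k2)" for i j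
    have "shift1 -` (residue_class (Suc i) k1 \<times> residue_class j k2) \<inter> pos_nat2
        = residue_class i k1 \<times> residue_class j k2" for i j
      by (auto simp: shift1_def residue_class_def pos_nat2_def pos_nat_def cong_Suc)
    then have N1: "N (Suc i) j = N i j" for i j
      using inv[OF _ residue_rect_subset, of shift1 "Suc i" k1 j k2] by (simp add: N_def)
    have "shift2 -` (residue_class i k1 \<times> residue_class (Suc j) k2) \<inter> pos_nat2
        = residue_class i k1 \<times> residue_class j k2" for i j
      by (auto simp: shift2_def residue_class_def pos_nat2_def pos_nat_def cong_Suc)
    then have N2: "N i (Suc j) = N i j" for i j
      using inv[OF _ residue_rect_subset, of shift2 i k1 "Suc j" k2] by (simp add: N_def)
    \<comment> \<open>The representatives are not confined below the moduli, so induction on each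
      index needs no wrap-around.\<close>
    have N0: "N i j = N 0 0" for i j
    proof -
      have "N i j = N 0 j" by (induction i) (simp_all add: N1)
      also have "\<dots> = N 0 0" by (induction j) (simp_all add: N2)
      finally show ?thesis .
    qed
    define R where "R = (\<lambda>(i, j). residue_class i k1 \<times> residue_class j k2)"
    define I where "I = {0..<k1} \<times> {0..<k2}"
    have cover: "pos_nat2 = (\<Union>p\<in>I. R p)"
    proof (intro equalityI subsetI)
      fix p assume "p \<in> pos_nat2"
      then obtain x y where xy: "p = (x, y)" "x \<in> pos_nat" "y \<in> pos_nat" by (auto simp: pos_nat2_def)
      then have "p \<in> R (x mod k1, y mod k2)" by (auto simp: R_def residue_class_def Cong.cong_def)
      moreover have "(x mod k1, y mod k2) \<in> I" using k by (auto simp: I_def pos_nat_def)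
      ultimately show "p \<in> (\<Union>p\<in>I. R p)" by blast
    qed (auto simp: R_def pos_nat2_def intro: subsetD[OF residue_class_subset])
    have "1 = \<mu> (\<Union>p\<in>I. R p)"
      using prob by (simp add: cover[symmetric] fin_add_prob_space)
    also have "\<dots> = (\<Sum>p\<in>I. \<mu> (R p))"
    proof (rule fin_add_prob_UN[OF prob])
      show "disjoint_family_on R I"
        by (auto simp: disjoint_family_on_def R_def I_def residue_class_def Cong.cong_def)
    qed (auto simp: R_def I_def pos_nat2_def intro: subsetD[OF residue_class_subset])
    also have "\<dots> = (\<Sum>p\<in>I. N 0 0)"
    proof (rule sum.cong[OF refl])
      fix p show "\<mu> (R p) = N 0 0"
        using N0[of "fst p" "snd p"] by (simp add: R_def N_def case_prod_beta)
    qed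
    also have "\<dots> = real k1 * real k2 * N 0 0"
      by (simp add: I_def card_cartesian_product)
    finally have "N 0 0 = 1 / (real k1 * real k2)"
      using k by (simp add: field_simps pos_nat_def)
    then show ?thesis using N0[of j1 j2] by (simp add: N_def)
  qed
  then show "\<mu> \<in> M_R" using prob unfolding M_R_def by blast
qed

lemma M_R_D:
  assumes "\<mu> \<in> M_R" "0 < k1" "0 < k2" "j1 < k1" "j2 < k2"
  shows "\<mu> (residue_class j1 k1 \<times> residue_class j2 k2) = 1 / (real k1 * real k2)"
  using assms by (auto simp: M_R_def pos_nat_def)

lemma M_R_prob: "\<mu> \<in> M_R \<Longrightarrow> fin_add_prob pos_nat2 \<mu>"
  by (simp add: M_R_def)

text \<open>Such a set is a finite disjoint union of residue rectangles modulo \<open>k\<close>,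
  each of prescribed charge. Only the pairs of \<open>S\<close> below \<open>k\<close>
  contribute.\<close>

lemma M_R_periodic_eq:
  assumes "\<mu> \<in> M_R" "\<nu> \<in> M_R" "0 < k"
    and A: "A = {(x, y) \<in> pos_nat2. (x mod k, y mod k) \<in> S}"
  shows "\<mu> A = \<nu> A"
proof -
  define R where "R = (\<lambda>(i, j). residue_class i k \<times> residue_class j k)"
  define I where "I = S \<inter> {0..<k} \<times> {0..<k}"
  have cover: "A = (\<Union>p\<in>I. R p)"
  proof (intro equalityI subsetI)
    fix p assume "p \<in> A"
    then obtain x y where xy: "p = (x, y)" "x \<in> pos_nat" "y \<in> pos_nat" "(x mod k, y mod k) \<in> S"
      by (auto simp: A pos_nat2_def)
    then have "p \<in> R (x mod k, y mod k)" by (auto simp: R_def residue_class_def Cong.cong_def)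
    moreover have "(x mod k, y mod k) \<in> I" using xy \<open>0 < k\<close> by (auto simp: I_def)
    ultimately show "p \<in> (\<Union>p\<in>I. R p)" by blast
  next
    fix p assume "p \<in> (\<Union>p\<in>I. R p)"
    then show "p \<in> A"
      by (auto simp: A R_def I_def residue_class_def Cong.cong_def pos_nat2_def)
  qed
  have eq: "\<rho> A = (\<Sum>p\<in>I. 1 / (real k * real k))" if \<rho>: "\<rho> \<in> M_R" for \<rho>
  proof -
    have "\<rho> A = (\<Sum>p\<in>I. \<rho> (R p))"
      unfolding cover
    proof (rule fin_add_prob_UN[OF M_R_prob[OF \<rho>]])
      show "disjoint_family_on R I"
        by (auto simp: disjoint_family_on_def R_def I_def residue_class_def Cong.cong_def)
    qed (auto simp: R_def I_def pos_nat2_def intro: subsetD[OF residue_class_subset])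
    also have "\<dots> = (\<Sum>p\<in>I. 1 / (real k * real k))"
      using M_R_D[OF \<rho>] by (intro sum.cong[OF refl]) (auto simp: R_def I_def)
    finally show ?thesis .
  qed
  show ?thesis using eq[OF assms(1)] eq[OF assms(2)] by simp
qed

section \<open>The truncated sieve and maximality at the coprime pairs\<close>

definition gcd_gt :: "nat \<Rightarrow> (nat \<times> nat) set" where
  "gcd_gt N = {(x, y) \<in> pos_nat2. gcd x y > N}"

text \<open>Ranging over all \<open>d\<close> and not only over primes lets the greatest common
  divisor itself be taken as \<open>d\<close>.\<close>

definition rough_pairs :: "nat \<Rightarrow> (nat \<times> nat) set" where
  "rough_pairs N = {(x, y) \<in> pos_nat2. \<forall>d\<in>{2..N}. \<not> (d dvd x \<and> d dvd y)}"

text \<open>Every \<open>d\<close> up to \<open>N\<close> divides \<open>fact N\<close>, which is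
  therefore a period of the sieve condition.\<close>

lemma M_R_rough_pairs_eq:
  assumes "\<mu> \<in> M_R" "\<nu> \<in> M_R"
  shows "\<mu> (rough_pairs N) = \<nu> (rough_pairs N)"
proof (rule M_R_periodic_eq[OF assms])
  have "d dvd x mod fact N \<longleftrightarrow> d dvd x" if "d \<in> {2..N}" for d x :: nat
    using that by (intro dvd_mod_iff) (auto intro: dvd_fact)
  then show "rough_pairs N = {(x, y) \<in> pos_nat2.
      (x mod fact N, y mod fact N) \<in> {(x, y). \<forall>d\<in>{2..N}. \<not> (d dvd x \<and> d dvd y)}}"
    by (auto simp: rough_pairs_def)
qed simp

lemma subset_pos_nat2: "coprime_pairs \<subseteq> pos_nat2" "gcd_gt N \<subseteq> pos_nat2" "rough_pairs N \<subseteq> pos_nat2"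
  by (auto simp: coprime_pairs_def gcd_gt_def rough_pairs_def)

lemma coprime_subset_rough: "coprime_pairs \<subseteq> rough_pairs N"
proof
  fix p assume "p \<in> coprime_pairs"
  then obtain x y where xy: "p = (x, y)" "(x, y) \<in> pos_nat2" "gcd x y = 1"
    by (auto simp: coprime_pairs_def)
  have "\<not> (d dvd x \<and> d dvd y)" if "d \<in> {2..N}" for d
    using that xy(3) gcd_greatest[of d x y] by auto
  then show "p \<in> rough_pairs N" using xy by (auto simp: rough_pairs_def)
qed

lemma rough_subset_coprime: "rough_pairs N \<subseteq> coprime_pairs \<union> gcd_gt N"
proof
  fix p assume "p \<in> rough_pairs N"
  then obtain x y where xy: "p = (x, y)" "(x, y) \<in> pos_nat2" "\<forall>d\<in>{2..N}. \<not> (d dvd x \<and> d dvd y)"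
    by (auto simp: rough_pairs_def)
  have "gcd x y \<notin> {2..N}" using xy(3) by (metis gcd_dvd1 gcd_dvd2)
  moreover have "gcd x y \<noteq> 0" using xy(2) by (auto simp: pos_nat2_def pos_nat_def)
  ultimately have "gcd x y = 1 \<or> gcd x y > N" unfolding atLeastAtMost_iff by linarith
  then show "p \<in> coprime_pairs \<union> gcd_gt N" using xy by (auto simp: coprime_pairs_def gcd_gt_def)
qed

text \<open>Monotonicity bounds \<mu> by the common charge of the rough pairs, and for \<nu> these
  overshoot the coprime pairs by at most the tail. If both tails vanish, using the inequality in
  both directions gives equality.\<close>

lemma M_R_coprime_le:
  assumes "\<mu> \<in> M_R" "\<nu> \<in> M_R" "(\<lambda>N. \<nu> (gcd_gt N)) \<longlonglongrightarrow> 0"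
  shows "\<mu> coprime_pairs \<le> \<nu> coprime_pairs"
proof -
  have le: "\<mu> coprime_pairs \<le> \<nu> coprime_pairs + \<nu> (gcd_gt N)" for N
  proof -
    have "\<mu> coprime_pairs \<le> \<mu> (rough_pairs N)"
      by (rule fin_add_prob_mono[OF M_R_prob[OF assms(1)] coprime_subset_rough subset_pos_nat2(3)])
    also have "\<dots> = \<nu> (rough_pairs N)" by (rule M_R_rough_pairs_eq[OF assms(1,2)])
    also have "\<dots> \<le> \<nu> (coprime_pairs \<union> gcd_gt N)"
      using subset_pos_nat2 by (intro fin_add_prob_mono[OF M_R_prob[OF assms(2)] rough_subset_coprime]) auto
    also have "\<dots> \<le> \<nu> coprime_pairs + \<nu> (gcd_gt N)"
      by (rule fin_add_prob_Un_le[OF M_R_prob[OF assms(2)] subset_pos_nat2(1,2)])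
    finally show ?thesis .
  qed
  have "(\<lambda>N. \<nu> coprime_pairs + \<nu> (gcd_gt N)) \<longlonglongrightarrow> \<nu> coprime_pairs + 0"
    using assms(3) by (intro tendsto_intros)
  then show ?thesis
    using LIMSEQ_le_const le by fastforce
qed

section \<open>Dilations and the value at the coprime pairs\<close>

definition dilate :: "nat \<Rightarrow> nat \<times> nat \<Rightarrow> nat \<times> nat" where
  "dilate d = (\<lambda>(x, y). (d * x, d * y))"

lemma inj_dilate: "0 < d \<Longrightarrow> inj (dilate d)"
  by (auto simp: inj_def dilate_def)

lemma dilate_image_subset: "0 < d \<Longrightarrow> A \<subseteq> pos_nat2 \<Longrightarrow> dilate d ` A \<subseteq> pos_nat2"
  by (auto simp: dilate_def pos_nat2_def pos_nat_def Suc_le_eq)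

text \<open>A number congruent to \<open>d * j\<close> modulo \<open>d * k\<close> is divisible by
  \<open>d\<close>, so the factor \<open>d\<close> cancels from the whole congruence.\<close>

lemma mult_image_residue_class:
  assumes "0 < d"
  shows "(*) d ` residue_class j k = residue_class (d * j) (d * k)"
proof (intro equalityI subsetI)
  fix x assume "x \<in> (*) d ` residue_class j k"
  then show "x \<in> residue_class (d * j) (d * k)"
    using assms by (auto simp: residue_class_def Cong.cong_def pos_nat_def simp flip: mult_mod_right)
next
  fix x assume x: "x \<in> residue_class (d * j) (d * k)"
  then have "[x = d * j] (mod d * k)" by (simp add: residue_class_def)
  then have "[x = d * j] (mod d)" by (rule cong_dvd_modulus_nat) simp
  then have "d dvd x" by (simp add: cong_dvd_iff)
  then obtain z where "x = d * z" by (elim dvdE)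
  then show "x \<in> (*) d ` residue_class j k"
    using x assms by (auto simp: residue_class_def Cong.cong_def pos_nat_def simp flip: mult_mod_right)
qed

lemma dilate_image_residue:
  assumes "0 < d"
  shows "dilate d ` (residue_class i k \<times> residue_class j l)
    = residue_class (d * i) (d * k) \<times> residue_class (d * j) (d * l)"
  unfolding mult_image_residue_class[OF assms, symmetric] by (auto simp: dilate_def)

text \<open>This is \<mu> conditioned on both coordinates being multiples of \<open>d\<close>, read
  in units of \<open>d\<close>. Each modulus grows by the factor \<open>d\<close>, so the charge of
  a residue rectangle drops by \<open>d\<close> squared, which the prefactor restores.\<close>

lemma M_R_dilate:
  assumes \<mu>: "\<mu> \<in> M_R" and d: "0 < d"
  shows "(\<lambda>A. (real d)\<^sup>2 * \<mu> (dilate d ` A)) \<in> M_R" (is "?\<nu> \<in> _")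
proof -
  note prob = M_R_prob[OF \<mu>]
  have res: "?\<nu> (residue_class j1 k1 \<times> residue_class j2 k2) = 1 / (real k1 * real k2)"
    if "j1 < k1" "j2 < k2" for j1 j2 k1 k2
    unfolding dilate_image_residue[OF d] using that d
    by (subst M_R_D[OF \<mu>]) (auto simp: power2_eq_square)
  \<comment> \<open>The whole space is the residue rectangle with both moduli 1, so normalization is
    a case of \<open>res\<close>.\<close>
  have space: "?\<nu> pos_nat2 = 1"
  proof -
    have "pos_nat2 = residue_class 0 1 \<times> residue_class 0 1"
      by (auto simp: pos_nat2_def residue_class_def)
    then show ?thesis using res[of 0 1 0 1] by simp
  qed
  have "fin_add_prob pos_nat2 ?\<nu>"
    unfolding fin_add_prob_def
  proof (intro conjI allI impI)
    fix A assume A: "A \<subseteq> pos_nat2"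
    have "\<mu> (dilate d ` A) \<le> \<mu> (dilate d ` pos_nat2)"
      using A d by (intro fin_add_prob_mono[OF prob] image_mono dilate_image_subset) auto
    then have "?\<nu> A \<le> ?\<nu> pos_nat2" by (intro mult_left_mono) auto
    moreover have "0 \<le> ?\<nu> A"
      using fin_add_prob_bounds(1)[OF prob dilate_image_subset[OF d A]] by simp
    ultimately show "?\<nu> A \<in> {0..1}" using space by simp
  next
    fix A B assume AB: "A \<subseteq> pos_nat2" "B \<subseteq> pos_nat2" "A \<inter> B = {}"
    have "dilate d ` A \<inter> dilate d ` B = {}"
      using AB(3) inj_dilate[OF d] by (simp flip: image_Int)
    then have "\<mu> (dilate d ` (A \<union> B)) = \<mu> (dilate d ` A) + \<mu> (dilate d ` B)"
      using fin_add_prob_Un[OF prob dilate_image_subset[OF d AB(1)] dilate_image_subset[OF d AB(2)]]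
      by (simp add: image_Un)
    then show "?\<nu> (A \<union> B) = ?\<nu> A + ?\<nu> B" by (simp add: distrib_left)
  qed (rule space)
  then show ?thesis using res by (auto simp: M_R_def)
qed

text \<open>A general constant \<open>c\<close> is allowed because dilation by \<open>d\<close>
  worsens the tail bound to \<open>d / N\<close>. At \<open>N = 0\<close> the quotient is 0 while
  the tail is the whole space, whence the restriction to positive \<open>N\<close>.\<close>

lemma M_R_gcd_gt_null:
  assumes \<mu>: "\<mu> \<in> M_R" and tail: "\<And>N. 0 < N \<Longrightarrow> \<mu> (gcd_gt N) \<le> c / real N"
  shows "(\<lambda>N. \<mu> (gcd_gt N)) \<longlonglongrightarrow> 0"
proof (rule tendsto_sandwich[OF _ _ tendsto_const lim_const_over_n[of c]])
  show "\<forall>\<^sub>F N in sequentially. 0 \<le> \<mu> (gcd_gt N)"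
    using fin_add_prob_bounds(1)[OF M_R_prob[OF \<mu>] subset_pos_nat2(2)] by simp
qed (use tail in \<open>auto intro!: eventually_sequentiallyI[of 1]\<close>)

text \<open>The rescaled charge \<open>\<nu>\<close> below has the same value at the coprime pairs as \<open>\<mu>\<close>, so the
  pairs with greatest common divisor \<open>d\<close> have charge \<open>\<mu> coprime_pairs / d\<^sup>2\<close>; summing over
  \<open>d\<close> gives \<open>1 = \<mu> coprime_pairs * (\<pi>\<^sup>2 / 6)\<close>.\<close>

lemma M_R_coprime_eq:
  assumes \<mu>: "\<mu> \<in> M_R" and tail: "\<And>N. 0 < N \<Longrightarrow> \<mu> (gcd_gt N) \<le> 1 / real N"
  shows "\<mu> coprime_pairs = 6 / pi\<^sup>2"
proof -
  note prob = M_R_prob[OF \<mu>]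
  have tail0: "(\<lambda>N. \<mu> (gcd_gt N)) \<longlonglongrightarrow> 0"
    by (rule M_R_gcd_gt_null[OF \<mu>, of 1]) (use tail in auto)
  define E where "E d = dilate d ` coprime_pairs" for d
  have E: "E d = {(x, y) \<in> pos_nat2. gcd x y = d}" if d: "0 < d" for d
  proof (intro equalityI subsetI)
    fix p assume "p \<in> E d"
    then show "p \<in> {(x, y) \<in> pos_nat2. gcd x y = d}"
      using d by (auto simp: E_def dilate_def coprime_pairs_def pos_nat2_def pos_nat_def gcd_mult_distrib_nat[symmetric] Suc_le_eq)
  next
    fix p assume "p \<in> {(x, y) \<in> pos_nat2. gcd x y = d}"
    then obtain x y where xy: "p = (x, y)" "(x, y) \<in> pos_nat2" "gcd x y = d" by auto
    then have "d dvd x" "d dvd y" by auto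
    then obtain x' y' where xy': "x = d * x'" "y = d * y'" by (elim dvdE)
    have "d * gcd x' y' = d" using xy(3) xy' by (simp add: gcd_mult_distrib_nat)
    then have "gcd x' y' = 1" using d by simp
    then have "(x', y') \<in> coprime_pairs"
      using xy xy' by (auto simp: coprime_pairs_def pos_nat2_def pos_nat_def intro!: Suc_leI gr0I)
    then show "p \<in> E d" using xy xy' by (auto simp: E_def dilate_def)
  qed
  have \<mu>E: "\<mu> (E d) = \<mu> coprime_pairs / (real d)\<^sup>2" if d: "0 < d" for d
  proof -
    let ?\<nu> = "\<lambda>A. (real d)\<^sup>2 * \<mu> (dilate d ` A)"
    have \<nu>: "?\<nu> \<in> M_R" by (rule M_R_dilate[OF \<mu> d])
    have "(\<lambda>N. ?\<nu> (gcd_gt N)) \<longlonglongrightarrow> 0"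
    proof (rule M_R_gcd_gt_null[OF \<nu>])
      fix N :: nat assume N: "0 < N"
      \<comment> \<open>Dilation multiplies the greatest common divisor by \<open>d\<close>, so the
        tail beyond \<open>N\<close> is moved into the tail beyond \<open>d * N\<close>.\<close>
      have "dilate d ` gcd_gt N \<subseteq> gcd_gt (d * N)"
        using d by (auto simp: dilate_def gcd_gt_def pos_nat2_def pos_nat_def gcd_mult_distrib_nat[symmetric] Suc_le_eq)
      then have "\<mu> (dilate d ` gcd_gt N) \<le> \<mu> (gcd_gt (d * N))"
        by (rule fin_add_prob_mono[OF prob _ subset_pos_nat2(2)])
      also have "\<dots> \<le> 1 / real (d * N)" using d N by (intro tail) simp
      finally have "?\<nu> (gcd_gt N) \<le> (real d)\<^sup>2 * (1 / real (d * N))"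
        by (intro mult_left_mono) auto
      then show "?\<nu> (gcd_gt N) \<le> real d / real N"
        using d N by (simp add: power2_eq_square)
    qed
    \<comment> \<open>Both charges have vanishing tails, so each dominates the other at the coprime
      pairs.\<close>
    then have "\<mu> coprime_pairs = ?\<nu> coprime_pairs"
      using M_R_coprime_le[OF \<mu> \<nu>] M_R_coprime_le[OF \<nu> \<mu> tail0] by simp
    then show ?thesis using d by (simp add: E_def field_simps)
  qed
  \<comment> \<open>The index starts at 0, so the divisor is \<open>n + 1\<close>, in accordance
    with the Basel series used for the limit.\<close>
  have split: "1 = \<mu> coprime_pairs * (\<Sum>n<N. 1 / (real n + 1)\<^sup>2) + \<mu> (gcd_gt N)" for N
  proof -
    have U: "(\<Union>n<N. E (n + 1)) = {(x, y) \<in> pos_nat2. gcd x y \<le> N}"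
    proof (intro equalityI subsetI)
      fix p assume "p \<in> (\<Union>n<N. E (n + 1))"
      then show "p \<in> {(x, y) \<in> pos_nat2. gcd x y \<le> N}" by (auto simp: E)
    next
      fix p assume "p \<in> {(x, y) \<in> pos_nat2. gcd x y \<le> N}"
      then obtain x y where xy: "p = (x, y)" "(x, y) \<in> pos_nat2" "gcd x y \<le> N" by auto
      then have "gcd x y \<noteq> 0" by (auto simp: pos_nat2_def pos_nat_def)
      then obtain n where n: "gcd x y = Suc n" using not0_implies_Suc by blast
      then have "p \<in> E (n + 1)" "n < N" using xy by (auto simp: E)
      then show "p \<in> (\<Union>n<N. E (n + 1))" by blast
    qed
    have "1 = \<mu> ((\<Union>n<N. E (n + 1)) \<union> gcd_gt N)"
    proof -
      have "pos_nat2 = (\<Union>n<N. E (n + 1)) \<union> gcd_gt N" unfolding U by (auto simp: gcd_gt_def)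
      then show ?thesis using fin_add_prob_space[OF prob] by simp
    qed
    also have "\<dots> = \<mu> (\<Union>n<N. E (n + 1)) + \<mu> (gcd_gt N)"
      unfolding U by (rule fin_add_prob_Un[OF prob]) (auto simp: gcd_gt_def)
    also have "\<mu> (\<Union>n<N. E (n + 1)) = (\<Sum>n<N. \<mu> (E (n + 1)))"
      by (rule fin_add_prob_UN[OF prob]) (auto simp: E disjoint_family_on_def)
    also have "\<dots> = \<mu> coprime_pairs * (\<Sum>n<N. 1 / (real n + 1)\<^sup>2)"
      by (simp add: \<mu>E sum_distrib_left add.commute)
    finally show ?thesis .
  qed
  have "(\<lambda>N. \<Sum>n<N. 1 / (real n + 1)\<^sup>2) \<longlonglongrightarrow> pi\<^sup>2 / 6"
    using inverse_squares_sums by (simp add: sums_def add.commute)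
  then have "(\<lambda>N. \<mu> coprime_pairs * (\<Sum>n<N. 1 / (real n + 1)\<^sup>2) + \<mu> (gcd_gt N))
      \<longlonglongrightarrow> \<mu> coprime_pairs * (pi\<^sup>2 / 6) + 0"
    using tail0 by (intro tendsto_intros)
  then have "(\<lambda>N. 1) \<longlonglongrightarrow> \<mu> coprime_pairs * (pi\<^sup>2 / 6)"
    by (simp flip: split)
  then have "\<mu> coprime_pairs * (pi\<^sup>2 / 6) = 1" by (simp add: LIMSEQ_const_iff)
  then show ?thesis by (simp add: field_simps)
qed

section \<open>Uniform tail bound and density of the coprime pairs\<close>

lemma sum_inverse_squares_tail:
  fixes N n :: nat
  assumes "0 < N"
  shows "(\<Sum>d\<in>{N<..n}. 1 / (real d)\<^sup>2) \<le> 1 / real N"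
proof (cases "N \<le> n")
  case True
  \<comment> \<open>The subtracted term makes the induction telescope, as 1/(n+1)^2 is at most 1/n -
    1/(n+1).\<close>
  then have "(\<Sum>d\<in>{N<..n}. 1 / (real d)\<^sup>2) \<le> 1 / real N - 1 / real n"
  proof (induction n rule: dec_induct)
    case (step n)
    have "1 / (real (Suc n))\<^sup>2 \<le> 1 / (real n * real (Suc n))"
      using assms step.hyps by (intro divide_left_mono) (auto simp: power2_eq_square)
    also have "\<dots> = 1 / real n - 1 / real (Suc n)"
      using assms step.hyps by (simp add: field_simps)
    finally have "1 / (real (Suc n))\<^sup>2 \<le> 1 / real n - 1 / real (Suc n)" .
    moreover have "{N<..Suc n} = insert (Suc n) {N<..n}" using step.hyps by auto
    ultimately show ?case using step.IH by simp
  qed simp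
  then show ?thesis by (smt (verit) divide_nonneg_nonneg of_nat_0_le_iff)
qed auto

lemma card_multiples_le: "card {x \<in> {1..n}. d dvd x} \<le> n div d" for d n :: nat
proof -
  have "{x \<in> {1..n}. d dvd x} \<subseteq> (*) d ` {1..n div d}"
  proof
    fix x assume "x \<in> {x \<in> {1..n}. d dvd x}"
    then obtain k where k: "x = d * k" "1 \<le> d * k" "d * k \<le> n" by auto
    \<comment> \<open>Positivity of \<open>x\<close> also disposes of \<open>d = 0\<close>.\<close>
    then have "0 < d" "0 < k" by (auto intro: gr0I)
    then show "x \<in> (*) d ` {1..n div d}"
      using k by (auto simp: less_eq_div_iff_mult_less_eq mult.commute)
  qed
  then show ?thesis
    using surj_card_le[of "{1..n div d}"] by fastforce
qed

text \<open>Union bound: both coordinates being multiples of \<open>d\<close> has frequency at most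
  1/d^2 in every box, and the sum over \<open>d\<close> beyond \<open>N\<close> is at most 1/N. The
  bound is uniform in the box, hence survives in cluster points.\<close>

lemma uniform_charge_gcd_gt:
  assumes N: "0 < N"
  shows "uniform_charge (box 0 m 0 n) (gcd_gt N) \<le> 1 / real N"
\<comment> \<open>An empty box has uniform charge 0 by the convention for division by zero.\<close>
proof (cases "m = 0 \<or> n = 0")
  case True
  then show ?thesis by (auto simp: uniform_charge_def box_def)
next
  case False
  define D where "D d n = {x \<in> {1..n}. d dvd x}" for d n :: nat
  have fin: "finite (D d n)" for d n by (simp add: D_def)
  have D: "real (card (D d n)) \<le> real n / real d" for d n
    using card_multiples_le[of n d] of_nat_div_le_of_nat[of n d, where 'a = real] unfolding D_def by linarith
  \<comment> \<open>The greatest common divisor divides the first coordinate, so it is at most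
    \<open>m\<close> and the union is finite.\<close>
  have "gcd_gt N \<inter> box 0 m 0 n \<subseteq> (\<Union>d\<in>{N<..m}. D d m \<times> D d n)"
  proof
    fix p assume "p \<in> gcd_gt N \<inter> box 0 m 0 n"
    then obtain x y where xy: "p = (x, y)" "x \<in> {1..m}" "y \<in> {1..n}" "gcd x y > N"
      by (auto simp: gcd_gt_def box_def)
    then have "gcd x y \<le> x" by (intro dvd_imp_le gcd_dvd1) simp
    then have "gcd x y \<in> {N<..m}" using xy by simp
    moreover have "p \<in> D (gcd x y) m \<times> D (gcd x y) n" using xy by (auto simp: D_def)
    ultimately show "p \<in> (\<Union>d\<in>{N<..m}. D d m \<times> D d n)" by blast
  qed
  then have "card (gcd_gt N \<inter> box 0 m 0 n) \<le> card (\<Union>d\<in>{N<..m}. D d m \<times> D d n)"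
    using fin by (intro card_mono) auto
  also have "\<dots> \<le> (\<Sum>d\<in>{N<..m}. card (D d m \<times> D d n))"
    by (rule card_UN_le) simp
  finally have "real (card (gcd_gt N \<inter> box 0 m 0 n)) \<le> (\<Sum>d\<in>{N<..m}. real (card (D d m)) * real (card (D d n)))"
    unfolding card_cartesian_product by (simp flip: of_nat_mult of_nat_sum)
  also have "\<dots> \<le> (\<Sum>d\<in>{N<..m}. (real m / real d) * (real n / real d))"
    by (intro sum_mono mult_mono D) auto
  also have "\<dots> = real m * real n * (\<Sum>d\<in>{N<..m}. 1 / (real d)\<^sup>2)"
    by (simp add: sum_distrib_left power2_eq_square)
  also have "\<dots> \<le> real m * real n * (1 / real N)"
    by (intro mult_left_mono sum_inverse_squares_tail N) auto
  finally show ?thesis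
    using False by (simp add: uniform_charge_def card_box field_simps)
qed

lemma rel_freq_eq: "rel_freq C (m, n) = uniform_charge (box 0 m 0 n) C"
  by (simp add: rel_freq_def uniform_charge_def card_box) (simp add: box_def)

lemma eventually_min_at_top:
  "eventually P min_at_top \<longleftrightarrow> (\<exists>N. \<forall>m\<ge>N. \<forall>n\<ge>N. P (m, n))"
  by (auto simp: min_at_top_def eventually_filtercomap_at_top_linorder)

lemma min_at_top_neq_bot: "min_at_top \<noteq> bot"
  by (auto simp: trivial_limit_def eventually_min_at_top)

text \<open>Allowing every filter finer than \<open>min_at_top\<close> serves two ends: it yields a
  charge attaining the maximum, and it shows that the relative frequency of the coprime pairs has no
  other cluster point.\<close>

lemma rel_freq_cluster:
  assumes "F \<noteq> bot" "F \<le> min_at_top"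
  obtains \<mu> F' where "\<mu> \<in> M_S" "F' \<le> F" "F' \<noteq> bot" "\<mu> coprime_pairs = 6 / pi\<^sup>2"
    "\<And>N. 0 < N \<Longrightarrow> \<mu> (gcd_gt N) \<le> 1 / real N"
    "\<And>A. A \<subseteq> pos_nat2 \<Longrightarrow> (rel_freq A \<longlongrightarrow> \<mu> A) F'"
proof -
  have "filterlim fst at_top min_at_top" "filterlim snd at_top min_at_top"
    by (auto simp: filterlim_at_top eventually_min_at_top)
  then have "filterlim fst at_top F" "filterlim snd at_top F"
    using assms(2) by (auto intro: filterlim_mono)
  from box_limit_M_S[OF assms(1) this, of "\<lambda>_. 0" "\<lambda>_. 0"] obtain \<mu> F' where
    \<mu>: "\<mu> \<in> M_S" "F' \<le> F" "F' \<noteq> bot" "\<And>A. A \<subseteq> pos_nat2 \<Longrightarrow>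
       ((\<lambda>p. uniform_charge (box 0 (fst p) 0 (snd p)) A) \<longlongrightarrow> \<mu> A) F'" by blast
  have "rel_freq A = (\<lambda>p. uniform_charge (box 0 (fst p) 0 (snd p)) A)" for A
    by (auto simp: rel_freq_eq)
  then have lim: "(rel_freq A \<longlongrightarrow> \<mu> A) F'" if "A \<subseteq> pos_nat2" for A
    using \<mu>(4)[OF that] by simp
  have tail: "\<mu> (gcd_gt N) \<le> 1 / real N" if "0 < N" for N
    by (rule tendsto_upperbound[OF \<mu>(4)[OF subset_pos_nat2(2)] _ \<mu>(3)])
       (simp add: uniform_charge_gcd_gt[OF that])
  moreover have "\<mu> coprime_pairs = 6 / pi\<^sup>2"
    using M_R_coprime_eq tail \<mu>(1) M_S_subset_M_R by blast
  ultimately show ?thesis using that \<mu>(1-3) lim by blast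
qed

text \<open>Compactness turns uniqueness of the cluster value into convergence, with no direct count
  of coprime pairs.\<close>

lemma rel_freq_coprime_pairs: "(rel_freq coprime_pairs \<longlongrightarrow> 6 / pi\<^sup>2) min_at_top"
proof (rule ccontr)
  assume "\<not> ?thesis"
  then obtain e where e: "0 < e" "\<not> (\<forall>\<^sub>F p in min_at_top. dist (rel_freq coprime_pairs p) (6 / pi\<^sup>2) < e)"
    by (auto simp: tendsto_iff)
  \<comment> \<open>Failure of convergence makes this restriction to the deviating rectangles a
    proper filter; a cluster point along it would have the value that the restriction
    excludes.\<close>
  define F where "F = inf min_at_top (principal {p. \<not> dist (rel_freq coprime_pairs p) (6 / pi\<^sup>2) < e})"
  have "F \<noteq> bot"
    using e(2) by (auto simp: F_def trivial_limit_def eventually_inf_principal)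
  moreover have "F \<le> min_at_top" by (simp add: F_def)
  ultimately obtain \<mu> F' where \<mu>: "F' \<le> F" "F' \<noteq> bot" "\<mu> coprime_pairs = 6 / pi\<^sup>2"
    "(rel_freq coprime_pairs \<longlongrightarrow> \<mu> coprime_pairs) F'"
    using rel_freq_cluster[of F] subset_pos_nat2(1) by metis
  have "\<forall>\<^sub>F p in F'. dist (rel_freq coprime_pairs p) (6 / pi\<^sup>2) < e"
    using \<mu>(3,4) e(1) by (auto simp: tendsto_iff)
  moreover have "\<forall>\<^sub>F p in F. \<not> dist (rel_freq coprime_pairs p) (6 / pi\<^sup>2) < e"
    by (simp add: F_def eventually_inf_principal)
  then have "\<forall>\<^sub>F p in F'. \<not> dist (rel_freq coprime_pairs p) (6 / pi\<^sup>2) < e"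
    by (rule filter_leD[OF \<mu>(1)])
  ultimately have "\<forall>\<^sub>F _ in F'. False" by eventually_elim simp
  then show False using \<mu>(2) by (simp add: trivial_limit_def)
qed

text \<open>Convergence fixes the value. That it is attained needs a member of \<open>M_F\<close>:
  any cluster charge qualifies, since limits along \<open>min_at_top\<close> persist along finer
  filters.\<close>

lemma value_range_M_F: "value_range coprime_pairs M_F = {6 / pi\<^sup>2}"
proof -
  have "coprime_pairs \<in> C_F"
    using rel_freq_coprime_pairs subset_pos_nat2(1) by (auto simp: C_F_def)
  then have eq: "\<mu> coprime_pairs = 6 / pi\<^sup>2" if "\<mu> \<in> M_F" for \<mu>
    using that rel_freq_coprime_pairs tendsto_unique[OF min_at_top_neq_bot] by (auto simp: M_F_def)
  obtain \<mu> F' where \<mu>: "\<mu> \<in> M_S" "F' \<le> min_at_top" "F' \<noteq> bot"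
    "\<And>A. A \<subseteq> pos_nat2 \<Longrightarrow> (rel_freq A \<longlongrightarrow> \<mu> A) F'"
    using rel_freq_cluster[OF min_at_top_neq_bot order_refl] by metis
  have "(rel_freq C \<longlongrightarrow> \<mu> C) min_at_top" if CF: "C \<in> C_F" for C
  proof -
    obtain L where L: "(rel_freq C \<longlongrightarrow> L) min_at_top" and C: "C \<subseteq> pos_nat2"
      using CF by (auto simp: C_F_def)
    then have "L = \<mu> C"
      using tendsto_unique[OF \<mu>(3) tendsto_mono[OF \<mu>(2) L] \<mu>(4)[OF C]] by simp
    then show ?thesis using L by simp
  qed
  then have "\<mu> \<in> M_F" using \<mu>(1) by (simp add: M_F_def M_S_def)
  then have "6 / pi\<^sup>2 \<in> value_range coprime_pairs M_F"
    unfolding value_range_def by (metis (mono_tags, lifting) eq mem_Collect_eq)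
  then show ?thesis using eq by (auto simp: value_range_def)
qed

section \<open>Squares without coprime pairs\<close>

text \<open>Each cell \<open>(i, j)\<close> gets its own prime, and the Chinese remainder theorem
  chooses \<open>a\<close> and \<open>b\<close> so that this prime divides both \<open>a + i\<close>
  and \<open>b + j\<close>.\<close>

lemma box_without_coprime_pairs: "\<exists>a b. coprime_pairs \<inter> box a n b n = {}"
proof -
  obtain g :: "nat \<Rightarrow> nat" where g: "inj g" "range g \<subseteq> {p. prime p}"
    using infinite_countable_subset[OF primes_infinite] by blast
  define q where "q = (\<lambda>p. g (prod_encode p))"
  have prime: "prime (q p)" for p using g(2) by (auto simp: q_def)
  have inj: "q p = q p' \<Longrightarrow> p = p'" for p p'
    using g(1) by (auto simp: q_def dest!: injD)
  define I where "I = {1..n} \<times> {1..n}"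
  have crt: "\<exists>a. \<forall>p\<in>I. q p dvd a + h p" for h :: "nat \<times> nat \<Rightarrow> nat"
  proof -
    \<comment> \<open>The multiple \<open>(q p - 1) * h p\<close> stands for minus
      \<open>h p\<close> modulo \<open>q p\<close>, avoiding negative numbers.\<close>
    have "\<exists>a. \<forall>p\<in>I. [a = (q p - 1) * h p] (mod q p)"
    proof (rule chinese_remainder_nat)
      show "\<forall>p\<in>I. \<forall>p'\<in>I. p \<noteq> p' \<longrightarrow> coprime (q p) (q p')"
        using primes_coprime[OF prime prime] inj by blast
    qed (simp add: I_def)
    then obtain a where a: "\<And>p. p \<in> I \<Longrightarrow> [a = (q p - 1) * h p] (mod q p)" by blast
    have "q p dvd a + h p" if "p \<in> I" for p
    proof -
      have "[a + h p = (q p - 1) * h p + h p] (mod q p)"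
        using a[OF that] by (intro cong_add cong_refl)
      moreover have "(q p - 1) * h p + h p = q p * h p"
        using prime_gt_0_nat[OF prime[of p]] by (cases "q p") auto
      ultimately show ?thesis by (simp add: cong_dvd_iff)
    qed
    then show ?thesis by blast
  qed
  obtain a where a: "\<And>p. p \<in> I \<Longrightarrow> q p dvd a + fst p" using crt by blast
  obtain b where b: "\<And>p. p \<in> I \<Longrightarrow> q p dvd b + snd p" using crt by blast
  have "(x, y) \<notin> coprime_pairs" if "(x, y) \<in> box a n b n" for x y
  proof
    assume G: "(x, y) \<in> coprime_pairs"
    define i where "i = x - a"
    define j where "j = y - b"
    have "x = a + i" "y = b + j" and I: "(i, j) \<in> I"
      using that by (auto simp: i_def j_def box_def I_def)
    then have "q (i, j) dvd gcd x y"
      using a[OF I] b[OF I] by (intro gcd_greatest) auto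
    moreover have "gcd x y = 1" using G by (simp add: coprime_pairs_def)
    ultimately have "q (i, j) dvd 1" by metis
    then show False using prime[of "(i, j)"] not_prime_unit by blast
  qed
  then show ?thesis by fastforce
qed

text \<open>The coprime-free squares of side \<open>n\<close> lie at offsets that vary with
  \<open>n\<close>; their growing sides alone make the cluster charge shift invariant.\<close>

lemma M_S_coprime_null: "\<exists>\<mu>\<in>M_S. \<mu> coprime_pairs = 0"
proof -
  obtain a b where ab: "\<And>n. coprime_pairs \<inter> box (a n) n (b n) n = {}"
    using box_without_coprime_pairs by metis
  from box_limit_M_S[OF sequentially_bot filterlim_ident filterlim_ident, of a b]
  obtain \<mu> F' where \<mu>: "\<mu> \<in> M_S" "F' \<noteq> bot"
    "\<And>A. A \<subseteq> pos_nat2 \<Longrightarrow>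
       ((\<lambda>n. uniform_charge (box (a n) n (b n) n) A) \<longlongrightarrow> \<mu> A) F'" by blast
  have "\<mu> coprime_pairs = 0"
    using tendsto_unique[OF \<mu>(2) \<mu>(3)[OF subset_pos_nat2(1)], of 0]
    by (simp add: uniform_charge_def ab)
  with \<mu>(1) show ?thesis by blast
qed

section \<open>Convexity and the ranges of values\<close>

lemma M_S_mix:
  assumes "\<mu> \<in> M_S" "\<nu> \<in> M_S" "0 \<le> t" "t \<le> 1"
  shows "(\<lambda>A. (1 - t) * \<mu> A + t * \<nu> A) \<in> M_S"
proof -
  have "fin_add_prob pos_nat2 (\<lambda>A. (1 - t) * \<mu> A + t * \<nu> A)"
    using assms by (intro fin_add_prob_mix) (auto simp: M_S_def)
  moreover have "\<rho> A = \<rho> (s -` A \<inter> pos_nat2)"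
    if "\<rho> \<in> M_S" "s \<in> {shift1, shift2}" "A \<subseteq> pos_nat2" for \<rho> s A
    using that unfolding M_S_def by blast
  ultimately show ?thesis using assms(1,2) unfolding M_S_def mem_Collect_eq by metis
qed

text \<open>The upper bound holds throughout \<open>M_R\<close>, while both endpoints are attained
  in \<open>M_S\<close>, and mixing the two extremal charges fills the interval. So
  \<open>M_S\<close> and \<open>M_R\<close> are treated at once.\<close>

lemma value_range_between:
  assumes "M_S \<subseteq> M" "M \<subseteq> M_R"
  shows "value_range coprime_pairs M = {0..6 / pi\<^sup>2}"
proof (intro equalityI subsetI)
  obtain \<nu> where \<nu>: "\<nu> \<in> M_S" "\<nu> coprime_pairs = 6 / pi\<^sup>2"
    "\<And>N. 0 < N \<Longrightarrow> \<nu> (gcd_gt N) \<le> 1 / real N"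
    using rel_freq_cluster[OF min_at_top_neq_bot order_refl] by metis
  fix r
  {
    assume "r \<in> value_range coprime_pairs M"
    then obtain \<mu> where \<mu>: "\<mu> \<in> M_R" "r = \<mu> coprime_pairs"
      using assms(2) by (auto simp: value_range_def)
    have "\<nu> \<in> M_R" using \<nu>(1) M_S_subset_M_R by blast
    then have "\<mu> coprime_pairs \<le> \<nu> coprime_pairs"
      using M_R_coprime_le[OF \<mu>(1)] M_R_gcd_gt_null[of \<nu> 1] \<nu>(3) by blast
    then show "r \<in> {0..6 / pi\<^sup>2}"
      using \<mu>(2) \<nu>(2) fin_add_prob_bounds(1)[OF M_R_prob[OF \<mu>(1)] subset_pos_nat2(1)] by simp
  next
    assume r: "r \<in> {0..6 / pi\<^sup>2}"
    obtain \<mu> where \<mu>: "\<mu> \<in> M_S" "\<mu> coprime_pairs = 0" using M_S_coprime_null by blast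
    \<comment> \<open>The weight solves t * 6/\<pi>^2 = r, the other charge contributing 0.\<close>
    define t where "t = r * pi\<^sup>2 / 6"
    have "(\<lambda>A. (1 - t) * \<mu> A + t * \<nu> A) \<in> M"
      using assms(1) M_S_mix[OF \<mu>(1) \<nu>(1), of t] r by (auto simp: t_def field_simps)
    moreover have "r = (1 - t) * \<mu> coprime_pairs + t * \<nu> coprime_pairs"
      using \<mu>(2) \<nu>(2) by (simp add: t_def)
    ultimately show "r \<in> value_range coprime_pairs M" unfolding value_range_def by (intro CollectI exI conjI)
  }
qed

theorem theorem2p4:
  shows "(\<forall>M\<in>{M_F, M_S, M_R}.
            value_range coprime_pairs M = {lower coprime_pairs M..upper coprime_pairs M})
       \<and> lower coprime_pairs M_F = 6 / pi\<^sup>2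
       \<and> upper coprime_pairs M_F = 6 / pi\<^sup>2
       \<and> upper coprime_pairs M_S = 6 / pi\<^sup>2
       \<and> upper coprime_pairs M_R = 6 / pi\<^sup>2
       \<and> lower coprime_pairs M_S = 0
       \<and> lower coprime_pairs M_R = 0"
proof -
  have c: "(0::real) \<le> 6 / pi\<^sup>2" by simp
  have S: "value_range coprime_pairs M_S = {0..6 / pi\<^sup>2}"
    and R: "value_range coprime_pairs M_R = {0..6 / pi\<^sup>2}"
    using M_S_subset_M_R by (auto intro!: value_range_between)
  show ?thesis
    using c by (simp add: lower_def upper_def S R value_range_M_F)
qed

end
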